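(* Let $A\in(\ell_\infty(\Delta^{(\tilde\alpha)}),\ell_\infty)$. Then $L_A$ is compact if and only if $$\lim_{r\to\infty}\sup_n\sum_{k=r+1}^\infty|\hat a_{nk}|=0.$$
   Context: $\omega$ is the set of all complex sequences $x=(x_k)_{k\ge0}$; $\ell_\infty$ (bounded sequences) carries the sup norm. Fix a fraction $\tilde\alpha$ (a real non-integer number). For $x\in\omega$ put $$(\Delta^{(\tilde\alpha)}x)_k=\sum_{i=0}^{k}(-1)^i\frac{\Gamma(\tilde\alpha+1)}{i!\,\Gamma(\tilde\alpha-i+1)}x_{k-i}$$ (terms with negative index are zero). Then $\ell_\infty(\Delta^{(\tilde\alpha)})=\{x\in\omega:\Delta^{(\tilde\alpha)}x\in\ell_\infty\}$, a Banach space with norm $\|x\|=\|\Delta^{(\tilde\alpha)}x\|_{\ell_\infty}$. For an infinite complex matrix $A=(a_{nk})_{n,k\ge0}$ and $X,Y\subset\omega$, $A\in(X,Y)$ means that for every $x\in X$ the series $A_nx=\sum_{k=0}^\infty a_{nk}x_k$ converges for all $n$ and $Ax=(A_nx)_{n\ge0}\in Y$. $L_A:X\to Y$ denotes the (bounded) operator $L_A(x)=Ax$. The matrix $\hat A=(\hat a_{nk})$ associated with $A$ is $$\hat a_{nk}=\sum_{j=k}^\infty(-1)^{j-k}\frac{\Gamma(-\tilde\alpha+1)}{(j-k)!\,\Gamma(-\tilde\alpha-j+k+1)}a_{nj}$$ (these series converge whenever $A$ maps $\ell_\infty(\Delta^{(\tilde\alpha)})$ into some subset of $\omega$). *)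

theory Defs
  imports "HOL-Analysis.Analysis"
begin

definition linf :: "(nat \<Rightarrow> complex) set"
  where "linf = {x. bounded (range x)}"

(* The supremum is taken in the reals, so this is only meaningful on linf. *)
definition linf_norm :: "(nat \<Rightarrow> complex) \<Rightarrow> real"
  where "linf_norm x = (SUP k. cmod (x k))"

(* For non-integer a, neither Gamma value lies at a pole, so this is (-1)^i times the
   generalised binomial coefficient of a over i. *)
definition frac_coeff :: "real \<Rightarrow> nat \<Rightarrow> real"
  where "frac_coeff a i = (-1) ^ i * (Gamma (a + 1) / (fact i * Gamma (a - real i + 1)))"

definition frac_diff :: "real \<Rightarrow> (nat \<Rightarrow> complex) \<Rightarrow> nat \<Rightarrow> complex"
  where "frac_diff a x k = (\<Sum>i\<le>k. of_real (frac_coeff a i) * x (k - i))"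

definition linf_diff :: "real \<Rightarrow> (nat \<Rightarrow> complex) set"
  where "linf_diff a = {x. frac_diff a x \<in> linf}"

definition linf_diff_norm :: "real \<Rightarrow> (nat \<Rightarrow> complex) \<Rightarrow> real"
  where "linf_diff_norm a x = linf_norm (frac_diff a x)"

definition mat_op :: "(nat \<Rightarrow> nat \<Rightarrow> complex) \<Rightarrow> (nat \<Rightarrow> complex) \<Rightarrow> nat \<Rightarrow> complex"
  where "mat_op A x n = (\<Sum>k. A n k * x k)"

definition mat_class ::
    "(nat \<Rightarrow> complex) set \<Rightarrow> (nat \<Rightarrow> complex) set \<Rightarrow> (nat \<Rightarrow> nat \<Rightarrow> complex) set"
  where "mat_class X Y =
    {A. \<forall>x\<in>X. (\<forall>n. summable (\<lambda>k. A n k * x k)) \<and> mat_op A x \<in> Y}"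

(* The series over j \<ge> k is re-indexed by j = k + i, which turns its coefficient into
   frac_coeff (-a) i. It may converge only conditionally. *)
definition assoc_mat ::
    "real \<Rightarrow> (nat \<Rightarrow> nat \<Rightarrow> complex) \<Rightarrow> nat \<Rightarrow> nat \<Rightarrow> complex"
  where "assoc_mat a A n k = (\<Sum>i. of_real (frac_coeff (-a) i) * A n (k + i))"

(* Compactness of a linear operator from the normed sequence space (X, nX) to (Y, nY):
   images of bounded sequences in X have subsequences converging in Y. *)
definition compact_operator ::
    "(nat \<Rightarrow> complex) set \<Rightarrow> ((nat \<Rightarrow> complex) \<Rightarrow> real) \<Rightarrow>
     (nat \<Rightarrow> complex) set \<Rightarrow> ((nat \<Rightarrow> complex) \<Rightarrow> real) \<Rightarrow>
     ((nat \<Rightarrow> complex) \<Rightarrow> (nat \<Rightarrow> complex)) \<Rightarrow> bool"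
  where "compact_operator X nX Y nY L \<longleftrightarrow>
    L ` X \<subseteq> Y \<and>
    (\<forall>x\<in>X. \<forall>y\<in>X. L (\<lambda>k. x k + y k) = (\<lambda>k. L x k + L y k)) \<and>
    (\<forall>c. \<forall>x\<in>X. L (\<lambda>k. c * x k) = (\<lambda>k. c * L x k)) \<and>
    (\<forall>s. (\<forall>m. s m \<in> X) \<and> (\<exists>M. \<forall>m. nX (s m) \<le> M) \<longrightarrow>
       (\<exists>f::nat \<Rightarrow> nat. strict_mono f \<and>
         (\<exists>y\<in>Y. (\<lambda>m. nY (\<lambda>k. L (s (f m)) k - y k)) \<longlonglongrightarrow> 0)))"

end

theory Submission
  imports Defs "HOL-Complex_Analysis.Great_Picard"
begin

text \<open>Vandermonde's identity makes the difference operators of orders \<open>\<alpha>\<close> and \<open>-\<alpha>\<close> mutually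
  inverse, so \<open>y = \<Delta>\<^sup>\<alpha> x\<close> ranges over all bounded sequences. The partial sums of the
  \<open>n\<close>-th series of \<open>Ax\<close> are triangular functionals of \<open>y\<close> that converge for every bounded \<open>y\<close>; by
  a gliding hump (Schur's theorem) their tails are uniformly small, which justifies summing by the
  columns of the associated matrix: \<open>(Ax)\<^sub>n = \<Sum>\<^sub>k a'\<^sub>n\<^sub>k y\<^sub>k\<close>, where \<open>a'\<close> has absolutely summable rows.

  If the tails of these rows are not uniformly small, then unit vectors \<open>y\<^sub>m\<close> supported beyond \<open>m\<close>
  and carrying the phases of a bad row have images of norm bounded below that tend to \<open>0\<close>
  coordinatewise, hence without a convergent subsequence. Conversely, with uniformly small
  tails a coordinatewise convergent subsequence of a bounded sequence has convergent images.\<close>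

section \<open>Inversion of the fractional difference operator\<close>

lemma frac_coeff_eq_gbinomial:
  assumes "a \<notin> \<int>"
  shows "frac_coeff a i = (-1) ^ i * (a gchoose i)"
proof -
  have "a + 1 \<notin> \<int>\<^sub>\<le>\<^sub>0"
    using assms by (metis Ints_1 Ints_diff add_diff_cancel_right' nonpos_Ints_Int)
  then show ?thesis
    unfolding frac_coeff_def by (subst gbinomial_Gamma) auto
qed

text \<open>The signs combine to \<open>(-1) ^ n\<close> and Vandermonde leaves the binomial
  coefficient of \<open>a + -a = 0\<close>, which vanishes for positive \<open>n\<close>. This is
  the identity (1 - X)^a (1 - X)^(-a) = 1 read off coefficientwise.\<close>

lemma frac_coeff_convolution:
  assumes "a \<notin> \<int>"
  shows "(\<Sum>i=0..n. frac_coeff a i * frac_coeff (-a) (n - i)) = (if n = 0 then 1 else 0)"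
proof -
  have "-a \<notin> \<int>" using assms by (simp add: minus_in_Ints_iff)
  then have "(\<Sum>i=0..n. frac_coeff a i * frac_coeff (-a) (n - i)) =
      (\<Sum>i=0..n. (-1) ^ n * ((a gchoose i) * (-a gchoose (n - i))))"
    using assms
    by (intro sum.cong refl) (auto simp: frac_coeff_eq_gbinomial simp flip: power_add)
  also have "\<dots> = (-1) ^ n * ((a + -a) gchoose n)"
    by (simp only: gbinomial_Vandermonde flip: sum_distrib_left)
  finally show ?thesis
    by (simp add: gbinomial_0_left)
qed

text \<open>As a Cauchy product, the operator becomes multiplication of formal power series, so that
  associativity there replaces the handling of double sums.\<close>

lemma frac_diff_eq_fps:
  "Abs_fps (frac_diff a x) = Abs_fps (\<lambda>i. of_real (frac_coeff a i)) * Abs_fps x"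
  by (rule fps_ext) (simp add: fps_mult_nth frac_diff_def atMost_atLeast0)

lemma frac_diff_inverse:
  assumes "a \<notin> \<int>"
  shows "frac_diff a (frac_diff (-a) x) = x"
proof -
  let ?c = "\<lambda>a. Abs_fps (\<lambda>i. complex_of_real (frac_coeff a i))"
  have "?c a * ?c (-a) = 1"
  proof (rule fps_ext)
    fix n
    have "fps_nth (?c a * ?c (-a)) n = of_real (\<Sum>i=0..n. frac_coeff a i * frac_coeff (-a) (n - i))"
      by (simp add: fps_mult_nth)
    then show "fps_nth (?c a * ?c (-a)) n = fps_nth 1 n"
      by (simp add: frac_coeff_convolution[OF assms])
  qed
  then have "Abs_fps (frac_diff a (frac_diff (-a) x)) = Abs_fps x"
    by (simp add: frac_diff_eq_fps flip: mult.assoc)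
  then show ?thesis
    by (simp add: fps_eq_iff fun_eq_iff)
qed

lemma frac_diff_inverse':
  assumes "a \<notin> \<int>"
  shows "frac_diff (-a) (frac_diff a x) = x"
  using frac_diff_inverse[of "-a" x] assms by (simp add: minus_in_Ints_iff)

section \<open>Bounded sequences and phases\<close>

lemma linfI: "(\<And>k. cmod (x k) \<le> M) \<Longrightarrow> x \<in> linf"
  unfolding linf_def bounded_iff by blast

lemma norm_le_linf_norm:
  assumes "x \<in> linf"
  shows "cmod (x k) \<le> linf_norm x"
proof -
  have "bdd_above (range (\<lambda>k. cmod (x k)))"
    using assms unfolding linf_def bounded_iff bdd_above_def by blast
  then show ?thesis
    unfolding linf_norm_def by (intro cSUP_upper) auto
qed

lemma linf_norm_le: "(\<And>k. cmod (x k) \<le> M) \<Longrightarrow> linf_norm x \<le> M"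
  unfolding linf_norm_def by (rule cSUP_least) auto

text \<open>Testing a row against these phases turns its sum into the sum of absolute values. As
  \<open>sgn 0 = 0\<close>, zero entries need no separate treatment.\<close>

lemma mult_cnj_sgn: "z * cnj (sgn z) = of_real (cmod z)"
proof (cases "z = 0")
  case False
  have "z * cnj (sgn z) = of_real ((cmod z)\<^sup>2) / of_real (cmod z)"
    unfolding complex_norm_square by (simp add: sgn_eq)
  with False show ?thesis
    by (simp add: power2_eq_square)
qed simp

lemma norm_cnj_sgn_le: "cmod (cnj (sgn z)) \<le> 1"
  by (simp add: norm_sgn)

section \<open>Gliding hump for triangular functionals\<close>

text \<open>Gliding hump: whichever value the functional has after the \<^term>\<open>r\<close>-th coordinate, one of
  the extensions of \<^term>\<open>y\<close> by zeros and by phases moves it by at least \<^term>\<open>e / 2\<close>.\<close>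

lemma triangular_hump:
  fixes b :: "nat \<Rightarrow> nat \<Rightarrow> complex"
  assumes y: "\<And>k. cmod (y k) \<le> 1" and J: "e < (\<Sum>k\<in>{r<..J}. cmod (b J k))" and "r < J"
  shows "\<exists>y'. (\<forall>k. cmod (y' k) \<le> 1) \<and> (\<forall>k\<le>r. y' k = y k) \<and>
    e / 2 \<le> cmod ((\<Sum>k\<le>J. b J k * y' k) - (\<Sum>k\<le>r. b r k * y k))"
proof -
  define z where "z v k = (if k \<le> r then y k else v k)" for v k
  define w where "w v = (\<Sum>k\<le>J. b J k * z v k) - (\<Sum>k\<le>r. b r k * y k)" for v
  let ?v = "\<lambda>k. cnj (sgn (b J k))"
  have split: "{..J} = {..r} \<union> {r<..J}" using \<open>r < J\<close> by auto
  have sum_z: "(\<Sum>k\<le>J. b J k * z v k) = (\<Sum>k\<le>r. b J k * y k) + (\<Sum>k\<in>{r<..J}. b J k * v k)" for v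
    unfolding split by (subst sum.union_disjoint) (auto simp: z_def)
  \<comment> \<open>The coordinates up to \<open>r\<close> and the old value cancel; only the block
    between \<open>r\<close> and \<open>J\<close> remains.\<close>
  have "w ?v - w (\<lambda>k. 0) = of_real (\<Sum>k\<in>{r<..J}. cmod (b J k))"
    by (simp add: w_def sum_z mult_cnj_sgn)
  then have "e < cmod (w ?v - w (\<lambda>k. 0))"
    using J by (simp only: norm_of_real)
  then have "e < cmod (w ?v) + cmod (w (\<lambda>k. 0))"
    using norm_triangle_ineq4[of "w ?v" "w (\<lambda>k. 0)"] by linarith
  then have "e / 2 \<le> cmod (w ?v) \<or> e / 2 \<le> cmod (w (\<lambda>k. 0))"
    by linarith
  moreover have "cmod (z ?v k) \<le> 1" "cmod (z (\<lambda>k. 0) k) \<le> 1" for k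
    using y norm_cnj_sgn_le[of "b J k"] by (auto simp: z_def)
  moreover have "\<forall>k\<le>r. z v k = y k" for v
    by (simp add: z_def)
  ultimately show ?thesis
    unfolding w_def by blast
qed

text \<open>Otherwise humps can be added forever: the sequences built on the way agree on growing
  prefixes and glue to one bounded \<open>y\<close> whose functionals keep jumping by
  \<open>e / 2\<close>, against convergence.\<close>

lemma triangular_uniform_tail:
  fixes b :: "nat \<Rightarrow> nat \<Rightarrow> complex"
  assumes conv: "\<And>y. (\<And>k. cmod (y k) \<le> 1) \<Longrightarrow> convergent (\<lambda>J. \<Sum>k\<le>J. b J k * y k)"
    and "e > 0"
  shows "\<exists>r. \<forall>J. (\<Sum>k\<in>{r<..J}. cmod (b J k)) \<le> e"
proof (rule ccontr)
  assume "\<not> ?thesis"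
  then have ex: "\<exists>J. e < (\<Sum>k\<in>{r<..J}. cmod (b J k))" for r
    by (metis not_le)
  \<comment> \<open>For \<open>J \<le> r\<close> the block is empty and its sum is 0, so a bad index
    lies beyond \<open>r\<close> by itself.\<close>
  have less: "r < J" if "e < (\<Sum>k\<in>{r<..J}. cmod (b J k))" for r J
    using that \<open>e > 0\<close> by (cases "r < J") auto
  \<comment> \<open>A state holds the last row used and the sequence built so far. A step keeps the
    coordinates up to that row and changes the functional by at least \<open>e / 2\<close>.\<close>
  define Q where "Q s t \<longleftrightarrow> fst s < (fst t :: nat) \<and> (\<forall>k\<le>fst s. snd t k = snd s k) \<and>
      e / 2 \<le> cmod ((\<Sum>k\<le>fst t. b (fst t) k * snd t k) - (\<Sum>k\<le>fst s. b (fst s) k * snd s k))"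
    for s t :: "nat \<times> (nat \<Rightarrow> complex)"
  have "\<exists>f. \<forall>n. (\<forall>k. cmod (snd (f n) k) \<le> 1) \<and> Q (f n) (f (Suc n))"
  proof (rule dependent_nat_choice)
    show "\<exists>s::nat \<times> (nat \<Rightarrow> complex). \<forall>k. cmod (snd s k) \<le> 1"
      by (rule exI[of _ "(0, \<lambda>_. 0)"]) simp
  next
    fix s :: "nat \<times> (nat \<Rightarrow> complex)" and n :: nat
    assume s: "\<forall>k. cmod (snd s k) \<le> 1"
    obtain J where J: "e < (\<Sum>k\<in>{fst s<..J}. cmod (b J k))"
      using ex by blast
    obtain y' where "\<forall>k. cmod (y' k) \<le> 1" "\<forall>k\<le>fst s. y' k = snd s k"
      "e / 2 \<le> cmod ((\<Sum>k\<le>J. b J k * y' k) - (\<Sum>k\<le>fst s. b (fst s) k * snd s k))"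
      using triangular_hump[where y = "snd s" and r = "fst s" and J = J and b = b and e = e] s J less[OF J] by blast
    then show "\<exists>t. (\<forall>k. cmod (snd t k) \<le> 1) \<and> Q s t"
      using less[OF J] by (intro exI[of _ "(J, y')"]) (auto simp: Q_def)
  qed
  then obtain f where f1: "\<And>n k. cmod (snd (f n) k) \<le> 1" and fQ: "\<And>n. Q (f n) (f (Suc n))"
    by blast
  have mono: "strict_mono (\<lambda>n. fst (f n))"
    using fQ by (intro strict_mono_Suc_iff[THEN iffD2]) (auto simp: Q_def)
  \<comment> \<open>The diagonal is well chosen: rows strictly increase, so
    \<open>k \<le> fst (f k)\<close> and coordinate \<open>k\<close> is frozen from stage
    \<open>k\<close> on.\<close>
  define y where "y k = snd (f k) k" for k
  have stable: "snd (f m) k = snd (f n) k" if "n \<le> m" "k \<le> fst (f n)" for m n k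
    using that
  proof (induction m rule: dec_induct)
    case (step m)
    have "fst (f n) \<le> fst (f m)"
      using step.hyps(1) strict_mono_less_eq[OF mono, of n m] by simp
    then show ?case
      using step fQ[of m] by (auto simp: Q_def)
  qed simp
  have y_eq: "y k = snd (f n) k" if "k \<le> fst (f n)" for k n
    unfolding y_def
    using stable[of k n k] stable[of n k k] that seq_suble[OF mono, of k]
    by (cases "k \<le> n") auto
  define F where "F J = (\<Sum>k\<le>J. b J k * y k)" for J
  have F_eq: "F (fst (f n)) = (\<Sum>k\<le>fst (f n). b (fst (f n)) k * snd (f n) k)" for n
    unfolding F_def by (intro sum.cong) (auto simp: y_eq)
  have "convergent F"
    unfolding F_def by (rule conv) (simp add: y_def f1)
  then obtain L where "(\<lambda>n. F (fst (f n))) \<longlonglongrightarrow> L"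
    unfolding convergent_def using LIMSEQ_subseq_LIMSEQ[OF _ mono] by (auto simp: o_def)
  then have "(\<lambda>n. F (fst (f (Suc n))) - F (fst (f n))) \<longlonglongrightarrow> L - L"
    by (intro tendsto_diff LIMSEQ_Suc)
  then have "(\<lambda>n. cmod (F (fst (f (Suc n))) - F (fst (f n)))) \<longlonglongrightarrow> 0"
    by (simp add: tendsto_norm_zero)
  moreover have "e / 2 \<le> cmod (F (fst (f (Suc n))) - F (fst (f n)))" for n
    using fQ[of n] by (simp add: F_eq Q_def)
  ultimately have "e / 2 \<le> 0"
    by (intro LIMSEQ_le_const) auto
  with \<open>e > 0\<close> show False by simp
qed

text \<open>Tails that are small uniformly in \<open>J\<close> allow the limit over \<open>J\<close>
  to be exchanged with the sum over \<open>k\<close>.\<close>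

lemma triangular_limit_sums:
  fixes b :: "nat \<Rightarrow> nat \<Rightarrow> complex"
  assumes conv: "\<And>y. y \<in> linf \<Longrightarrow> convergent (\<lambda>J. \<Sum>k\<le>J. b J k * y k)"
    and \<beta>: "\<And>k. (\<lambda>J. b J k) \<longlonglongrightarrow> \<beta> k"
    and y: "y \<in> linf" and L: "(\<lambda>J. \<Sum>k\<le>J. b J k * y k) \<longlonglongrightarrow> L"
  shows "(\<lambda>k. \<beta> k * y k) sums L"
  unfolding sums_def_le
proof (rule LIMSEQ_I)
  fix e :: real assume "e > 0"
  \<comment> \<open>The added 1 keeps \<open>M\<close> positive for \<open>y = 0\<close>, so that
    \<open>e / (2 * M)\<close> is a legitimate tolerance.\<close>
  define M where "M = linf_norm y + 1"
  have yM: "cmod (y k) \<le> M" for k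
    using norm_le_linf_norm[OF y, of k] by (simp add: M_def)
  have "M > 0"
    using norm_le_linf_norm[OF y, of 0] norm_ge_zero[of "y 0"] unfolding M_def by linarith
  obtain r where r: "\<And>J. (\<Sum>k\<in>{r<..J}. cmod (b J k)) \<le> e / (2 * M)"
  proof -
    have "\<exists>r. \<forall>J. (\<Sum>k\<in>{r<..J}. cmod (b J k)) \<le> e / (2 * M)"
      using \<open>e > 0\<close> \<open>M > 0\<close> by (intro triangular_uniform_tail conv) (auto intro: linfI)
    with that show ?thesis by blast
  qed
  have "cmod (L - (\<Sum>k\<le>N. \<beta> k * y k)) \<le> e / 2" if "N \<ge> r" for N
  proof -
    \<comment> \<open>With \<open>N\<close> fixed only finitely many columns enter the second sum.
      The bound on the block after \<open>N\<close>, valid for all \<open>J \<ge> N\<close>, passes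
      to the limit.\<close>
    have "(\<lambda>J. cmod ((\<Sum>k\<le>J. b J k * y k) - (\<Sum>k\<le>N. b J k * y k)))
        \<longlonglongrightarrow> cmod (L - (\<Sum>k\<le>N. \<beta> k * y k))"
      by (intro tendsto_intros L \<beta>)
    moreover have "cmod ((\<Sum>k\<le>J. b J k * y k) - (\<Sum>k\<le>N. b J k * y k)) \<le> e / 2"
      if "J \<ge> N" for J
    proof -
      have split: "{..J} = {..N} \<union> {N<..J}" using \<open>J \<ge> N\<close> by auto
      have "(\<Sum>k\<le>J. b J k * y k) - (\<Sum>k\<le>N. b J k * y k) = (\<Sum>k\<in>{N<..J}. b J k * y k)"
        unfolding split by (subst sum.union_disjoint) auto
      also have "cmod \<dots> \<le> (\<Sum>k\<in>{N<..J}. cmod (b J k) * M)"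
        by (intro sum_norm_le) (simp add: norm_mult mult_left_mono yM)
      also have "\<dots> \<le> (\<Sum>k\<in>{r<..J}. cmod (b J k) * M)"
        using \<open>N \<ge> r\<close> \<open>M > 0\<close> by (intro sum_mono2) auto
      also have "\<dots> \<le> e / (2 * M) * M"
        using r[of J] \<open>M > 0\<close> by (simp only: flip: sum_distrib_right) (rule mult_right_mono, auto)
      also have "\<dots> = e / 2"
        using \<open>M > 0\<close> by simp
      finally show ?thesis .
    qed
    ultimately show ?thesis
      by (intro LIMSEQ_le_const2) auto
  qed
  then show "\<exists>no. \<forall>N\<ge>no. norm ((\<Sum>k\<le>N. \<beta> k * y k) - L) < e"
    using \<open>e > 0\<close> by (intro exI[of _ r]) (fastforce simp: norm_minus_commute)
qed

section \<open>Rows and columns of the associated matrix\<close>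

text \<open>Substituting \<open>j = k + i\<close> reorders the sum over a triangle. For
  \<open>c = -\<alpha>\<close> the coefficient of \<open>y k\<close> is a truncation of the series
  that defines the associated matrix.\<close>

lemma sum_frac_diff_eq:
  fixes a :: "nat \<Rightarrow> complex"
  shows "(\<Sum>j\<le>J. a j * frac_diff c y j) =
    (\<Sum>k\<le>J. (\<Sum>i\<le>J - k. of_real (frac_coeff c i) * a (k + i)) * y k)"
proof -
  have "(\<Sum>j\<le>J. a j * frac_diff c y j) =
      (\<Sum>j\<le>J. \<Sum>i\<le>j. of_real (frac_coeff c i) * a ((j - i) + i) * y (j - i))"
    unfolding frac_diff_def sum_distrib_left by (intro sum.cong refl) (simp add: mult_ac)
  also have "\<dots> = (\<Sum>(j, i)\<in>(SIGMA j:{..J}. {..j}). of_real (frac_coeff c i) * a ((j - i) + i) * y (j - i))"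
    by (rule sum.Sigma) auto
  also have "\<dots> = (\<Sum>(k, i)\<in>(SIGMA k:{..J}. {..J - k}). of_real (frac_coeff c i) * a (k + i) * y k)"
    by (rule sum.reindex_bij_witness[where i = "\<lambda>(k, i). (k + i, i)" and j = "\<lambda>(j, i). (j - i, i)"])
       auto
  also have "\<dots> = (\<Sum>k\<le>J. (\<Sum>i\<le>J - k. of_real (frac_coeff c i) * a (k + i)) * y k)"
    by (simp add: sum_distrib_right flip: sum.Sigma)
  finally show ?thesis .
qed

lemma frac_diff_neg_in_linf_diff:
  assumes "\<alpha> \<notin> \<int>" "y \<in> linf"
  shows "frac_diff (-\<alpha>) y \<in> linf_diff \<alpha>"
  using assms by (simp add: linf_diff_def frac_diff_inverse)

text \<open>Convergence of the defining series comes from testing \<open>A\<close> on the inverse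
  difference of the unit vector at \<open>k\<close>, whose entries from \<open>k\<close> on are the
  coefficients \<open>frac_coeff (-\<alpha>) i\<close>.\<close>

lemma assoc_row_LIMSEQ:
  assumes \<alpha>: "\<alpha> \<notin> \<int>" and A: "A \<in> mat_class (linf_diff \<alpha>) Y"
  shows "(\<lambda>J. \<Sum>i\<le>J - k. of_real (frac_coeff (-\<alpha>) i) * A n (k + i)) \<longlonglongrightarrow> assoc_mat \<alpha> A n k"
proof -
  define u :: "nat \<Rightarrow> complex" where "u i = (if i = k then 1 else 0)" for i
  have "u \<in> linf"
    by (rule linfI[of _ 1]) (simp add: u_def)
  then have "summable (\<lambda>j. A n j * frac_diff (-\<alpha>) u j)"
    using A frac_diff_neg_in_linf_diff[OF \<alpha>] by (auto simp: mat_class_def)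
  then have "summable (\<lambda>i. A n (i + k) * frac_diff (-\<alpha>) u (i + k))"
    by (rule summable_ignore_initial_segment)
  moreover have "frac_diff (-\<alpha>) u (i + k) = of_real (frac_coeff (-\<alpha>) i)" for i
  proof -
    have "frac_diff (-\<alpha>) u (i + k) = (\<Sum>j\<le>i + k. if j = i then of_real (frac_coeff (-\<alpha>) i) else 0)"
      unfolding frac_diff_def by (intro sum.cong) (auto simp: u_def)
    then show ?thesis by simp
  qed
  ultimately have "summable (\<lambda>i. of_real (frac_coeff (-\<alpha>) i) * A n (k + i))"
    by (simp add: mult.commute add.commute)
  then have "(\<lambda>J. \<Sum>i\<le>J. of_real (frac_coeff (-\<alpha>) i) * A n (k + i)) \<longlonglongrightarrow> assoc_mat \<alpha> A n k"
    unfolding assoc_mat_def by (rule summable_LIMSEQ')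
  then show ?thesis
    by (rule filterlim_compose[OF _ filterlim_minus_const_nat_at_top])
qed

lemma assoc_mat_sums:
  assumes \<alpha>: "\<alpha> \<notin> \<int>" and A: "A \<in> mat_class (linf_diff \<alpha>) Y" and x: "x \<in> linf_diff \<alpha>"
  shows "(\<lambda>k. assoc_mat \<alpha> A n k * frac_diff \<alpha> x k) sums mat_op A x n"
proof (rule triangular_limit_sums)
  let ?b = "\<lambda>J k. \<Sum>i\<le>J - k. of_real (frac_coeff (-\<alpha>) i) * A n (k + i)"
  \<comment> \<open>All bounded \<open>y\<close> are treated, not only the difference of
    \<open>x\<close>, because the gliding hump chooses its own test sequence.\<close>
  have lim: "(\<lambda>J. \<Sum>k\<le>J. ?b J k * y k) \<longlonglongrightarrow> mat_op A (frac_diff (-\<alpha>) y) n"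
    if "y \<in> linf" for y
  proof -
    have "summable (\<lambda>j. A n j * frac_diff (-\<alpha>) y j)"
      using A frac_diff_neg_in_linf_diff[OF \<alpha> that] by (auto simp: mat_class_def)
    from summable_LIMSEQ'[OF this] show ?thesis
      by (simp add: sum_frac_diff_eq mat_op_def)
  qed
  show "convergent (\<lambda>J. \<Sum>k\<le>J. ?b J k * y k)" if "y \<in> linf" for y
    using lim[OF that] by (rule convergentI)
  show "(\<lambda>J. ?b J k) \<longlonglongrightarrow> assoc_mat \<alpha> A n k" for k
    by (rule assoc_row_LIMSEQ[OF \<alpha> A])
  show fx: "frac_diff \<alpha> x \<in> linf"
    using x by (simp add: linf_diff_def)
  show "(\<lambda>J. \<Sum>k\<le>J. ?b J k * frac_diff \<alpha> x k) \<longlonglongrightarrow> mat_op A x n"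
    using lim[OF fx] by (simp add: frac_diff_inverse'[OF \<alpha>])
qed

lemma assoc_mat_sums':
  assumes "\<alpha> \<notin> \<int>" "A \<in> mat_class (linf_diff \<alpha>) Y" "y \<in> linf"
  shows "(\<lambda>k. assoc_mat \<alpha> A n k * y k) sums mat_op A (frac_diff (-\<alpha>) y) n"
  using assoc_mat_sums[OF assms(1,2) frac_diff_neg_in_linf_diff[OF assms(1,3)]] assms(1)
  by (simp add: frac_diff_inverse)

text \<open>The row is summed against its own phases, which form a bounded sequence.\<close>

lemma assoc_mat_abs_summable:
  assumes "\<alpha> \<notin> \<int>" "A \<in> mat_class (linf_diff \<alpha>) Y"
  shows "summable (\<lambda>k. cmod (assoc_mat \<alpha> A n k))"
proof -
  have "(\<lambda>k. cnj (sgn (assoc_mat \<alpha> A n k))) \<in> linf"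
    using norm_cnj_sgn_le by (rule linfI)
  from sums_summable[OF assoc_mat_sums'[OF assms this, of n]]
  have "summable (\<lambda>k. complex_of_real (cmod (assoc_mat \<alpha> A n k)))"
    by (simp add: mult_cnj_sgn)
  then show ?thesis
    by (simp add: summable_of_real_iff)
qed

text \<open>Column \<open>k\<close> is the image of the inverse difference of a unit vector, hence
  bounded. This controls finitely many columns uniformly in \<open>n\<close>.\<close>

lemma assoc_mat_col_bounded:
  assumes "\<alpha> \<notin> \<int>" "A \<in> mat_class (linf_diff \<alpha>) linf"
  shows "\<exists>B. \<forall>n. cmod (assoc_mat \<alpha> A n k) \<le> B"
proof -
  define u :: "nat \<Rightarrow> complex" where "u i = (if i = k then 1 else 0)" for i
  have u: "u \<in> linf"
    by (rule linfI[of _ 1]) (simp add: u_def)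
  have "assoc_mat \<alpha> A n k = mat_op A (frac_diff (-\<alpha>) u) n" for n
  proof (rule sums_unique2)
    show "(\<lambda>j. assoc_mat \<alpha> A n j * u j) sums mat_op A (frac_diff (-\<alpha>) u) n"
      by (rule assoc_mat_sums'[OF assms u])
    have "(\<lambda>j. assoc_mat \<alpha> A n j * u j) = (\<lambda>j. if j = k then assoc_mat \<alpha> A n j else 0)"
      by (auto simp: u_def)
    then show "(\<lambda>j. assoc_mat \<alpha> A n j * u j) sums assoc_mat \<alpha> A n k"
      using sums_single[of k "\<lambda>j. assoc_mat \<alpha> A n j"] by simp
  qed
  moreover have "mat_op A (frac_diff (-\<alpha>) u) \<in> linf"
    using assms(2) frac_diff_neg_in_linf_diff[OF assms(1) u] by (auto simp: mat_class_def)
  ultimately show ?thesis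
    using norm_le_linf_norm by auto
qed

section \<open>The tail condition in epsilon form\<close>

text \<open>In \<open>ennreal\<close> the supremum makes sense even for unbounded families; since
  \<open>e\<close> is positive, truncating negative values to 0 does not affect the
  comparison.\<close>

lemma SUP_ennreal_tendsto_zero_iff:
  fixes g :: "nat \<Rightarrow> 'a \<Rightarrow> real"
  shows "(\<lambda>r. SUP n. ennreal (g r n)) \<longlonglongrightarrow> 0 \<longleftrightarrow>
    (\<forall>e>0. \<forall>\<^sub>F r in sequentially. \<forall>n. g r n \<le> e)"
proof (intro iffI allI impI)
  fix e :: real assume lim: "(\<lambda>r. SUP n. ennreal (g r n)) \<longlonglongrightarrow> 0" and "e > 0"
  have "\<forall>\<^sub>F r in sequentially. (SUP n. ennreal (g r n)) < ennreal e"
    using \<open>e > 0\<close> by (intro order_tendstoD(2)[OF lim]) simp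
  then show "\<forall>\<^sub>F r in sequentially. \<forall>n. g r n \<le> e"
  proof eventually_elim
    case (elim r)
    have "ennreal (g r n) \<le> ennreal e" for n
    proof -
      have "ennreal (g r n) \<le> (SUP n. ennreal (g r n))"
        by (rule SUP_upper) simp
      with elim show ?thesis by order
    qed
    then show ?case
      using \<open>e > 0\<close> by (simp add: ennreal_le_iff)
  qed
next
  assume small: "\<forall>e>0. \<forall>\<^sub>F r in sequentially. \<forall>n. g r n \<le> e"
  show "(\<lambda>r. SUP n. ennreal (g r n)) \<longlonglongrightarrow> 0"
  proof (rule order_tendstoI)
    fix a :: ennreal assume "0 < a"
    \<comment> \<open>An intermediate \<open>c\<close> is finite even when \<open>a\<close> is
      infinite, so it comes from a real \<open>e\<close>.\<close>
    then obtain c where c: "0 < c" "c < a"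
      using dense by blast
    then obtain e where e: "c = ennreal e" "e > 0"
      by (cases c) (auto simp: ennreal_less_zero_iff)
    then have "\<forall>\<^sub>F r in sequentially. \<forall>n. g r n \<le> e"
      using small by blast
    then show "\<forall>\<^sub>F r in sequentially. (SUP n. ennreal (g r n)) < a"
    proof eventually_elim
      case (elim r)
      then have "(SUP n. ennreal (g r n)) \<le> c"
        by (intro SUP_least) (simp add: e ennreal_leI)
      with c show ?case by simp
    qed
  qed simp
qed

section \<open>Compactness forces uniformly small tails\<close>

lemma compact_imp_uniform_tail:
  assumes \<alpha>: "\<alpha> \<notin> \<int>" and A: "A \<in> mat_class (linf_diff \<alpha>) linf"
    and compact: "compact_operator (linf_diff \<alpha>) (linf_diff_norm \<alpha>) linf linf_norm (mat_op A)"
    and "e > 0"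
  shows "\<forall>\<^sub>F r in sequentially. \<forall>n. (\<Sum>k. cmod (assoc_mat \<alpha> A n (r + 1 + k))) \<le> e"
proof (rule ccontr)
  let ?a = "assoc_mat \<alpha> A"
  let ?tail = "\<lambda>r n. \<Sum>k. cmod (?a n (r + 1 + k))"
  assume "\<not> ?thesis"
  then have "\<exists>r n. r \<ge> m \<and> e < ?tail r n" for m
    unfolding eventually_sequentially by (meson not_le)
  then obtain r n where r: "\<And>m. r m \<ge> m" and n: "\<And>m. e < ?tail (r m) (n m)"
    by metis
  \<comment> \<open>The cutoff leaves only columns beyond \<open>r m\<close>; the phases of row
    \<open>n m\<close> make the image at \<open>n m\<close> equal to the large tail.\<close>
  define y where "y m k = (if k \<le> r m then 0 else cnj (sgn (?a (n m) k)))" for m k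
  have y_le: "cmod (y m k) \<le> 1" for m k
    using norm_cnj_sgn_le[of "?a (n m) k"] by (simp add: y_def)
  have y: "y m \<in> linf" for m
    using y_le by (rule linfI)
  define s where "s m = frac_diff (-\<alpha>) (y m)" for m
  have s: "s m \<in> linf_diff \<alpha>" for m
    unfolding s_def by (rule frac_diff_neg_in_linf_diff[OF \<alpha> y])
  have As: "mat_op A (s m) \<in> linf" for m
    using A s[of m] by (auto simp: mat_class_def)
  have "linf_diff_norm \<alpha> (s m) \<le> 1" for m
    using linf_norm_le[of "y m"] y_le by (simp add: linf_diff_norm_def s_def frac_diff_inverse[OF \<alpha>])
  then obtain f z where f: "strict_mono f" and z: "z \<in> linf"
    and lim: "(\<lambda>m. linf_norm (\<lambda>k. mat_op A (s (f m)) k - z k)) \<longlonglongrightarrow> 0"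
    using compact s unfolding compact_operator_def by meson
  have As_sums: "(\<lambda>k. ?a i (r m + 1 + k) * y m (r m + 1 + k)) sums mat_op A (s m) i" for i m
  proof -
    have "(\<lambda>k. ?a i k * y m k) sums mat_op A (s m) i"
      unfolding s_def by (rule assoc_mat_sums'[OF \<alpha> A y])
    from sums_split_initial_segment[OF this, of "r m + 1"]
    show ?thesis
      by (simp add: y_def add_ac)
  qed
  have summ: "summable (\<lambda>k. cmod (?a i (j + 1 + k)))" for i j
    using summable_ignore_initial_segment[OF assoc_mat_abs_summable[OF \<alpha> A, of i], of "j + 1"]
    by (simp add: add_ac)
  have peak: "mat_op A (s m) (n m) = of_real (?tail (r m) (n m))" for m
  proof (rule sums_unique2[OF As_sums])
    show "(\<lambda>k. ?a (n m) (r m + 1 + k) * y m (r m + 1 + k)) sums of_real (?tail (r m) (n m))"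
      using sums_of_real[OF summable_sums[OF summ[of "n m" "r m"]], where 'a = complex]
      by (simp add: y_def mult_cnj_sgn)
  qed
  have big: "e < cmod (mat_op A (s m) (n m))" for m
    using n[of m] abs_ge_self[of "?tail (r m) (n m)"] unfolding peak norm_of_real by linarith
  \<comment> \<open>For a fixed row \<open>i\<close> the image is dominated by the tail of that row
    beyond \<open>r m \<ge> m\<close>.\<close>
  have coord: "(\<lambda>m. mat_op A (s m) i) \<longlonglongrightarrow> 0" for i
  proof (rule Lim_null_comparison)
    show "\<forall>\<^sub>F m in sequentially. cmod (mat_op A (s m) i) \<le> ?tail (r m) i"
    proof (intro always_eventually allI)
      fix m
      have "cmod (\<Sum>k. ?a i (r m + 1 + k) * y m (r m + 1 + k)) \<le> ?tail (r m) i"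
        using y_le by (intro norm_suminf_le summ) (simp add: norm_mult mult_left_le)
      then show "cmod (mat_op A (s m) i) \<le> ?tail (r m) i"
        using sums_unique[OF As_sums[of i m]] by simp
    qed
    have "(\<lambda>j. \<Sum>k. cmod (?a i (k + j))) \<longlonglongrightarrow> 0"
      by (rule suminf_exist_split2[OF assoc_mat_abs_summable[OF \<alpha> A]])
    from LIMSEQ_Suc[OF this] have "(\<lambda>j. ?tail j i) \<longlonglongrightarrow> 0"
      by (simp add: add_ac)
    moreover have "filterlim r at_top sequentially"
      using r by (intro filterlim_at_top_mono[OF filterlim_ident]) auto
    ultimately show "(\<lambda>m. ?tail (r m) i) \<longlonglongrightarrow> 0"
      by (rule filterlim_compose)
  qed
  \<comment> \<open>Only for members of \<open>linf\<close> does \<open>linf_norm\<close> dominate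
    the coordinates.\<close>
  have diff_linf: "(\<lambda>k. mat_op A (s m) k - z k) \<in> linf" for m
  proof (rule linfI)
    fix k
    show "cmod (mat_op A (s m) k - z k) \<le> linf_norm (mat_op A (s m)) + linf_norm z"
      using norm_triangle_ineq4[of "mat_op A (s m) k" "z k"]
        norm_le_linf_norm[OF As[of m], of k] norm_le_linf_norm[OF z, of k] by linarith
  qed
  \<comment> \<open>Norm convergence implies coordinatewise convergence, so the limit must be 0,
    although the images have norm above \<open>e\<close>.\<close>
  have "z i = 0" for i
  proof -
    have "(\<lambda>m. mat_op A (s (f m)) i - z i) \<longlonglongrightarrow> 0"
      using lim by (rule Lim_null_comparison[rotated]) (simp add: norm_le_linf_norm[OF diff_linf])
    moreover have "(\<lambda>m. mat_op A (s (f m)) i - z i) \<longlonglongrightarrow> 0 - z i"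
      using LIMSEQ_subseq_LIMSEQ[OF coord f] by (intro tendsto_intros) (simp add: o_def)
    ultimately show ?thesis
      by (auto dest: LIMSEQ_unique)
  qed
  then have "e \<le> linf_norm (\<lambda>k. mat_op A (s (f m)) k - z k)" for m
    using big[of "f m"] norm_le_linf_norm[OF diff_linf[of "f m"], of "n (f m)"] by simp
  then have "e \<le> 0"
    by (intro LIMSEQ_le_const[OF lim]) auto
  with \<open>e > 0\<close> show False by simp
qed

section \<open>Uniformly small tails give compactness\<close>

lemma uniform_tail_imp_compact:
  assumes \<alpha>: "\<alpha> \<notin> \<int>" and A: "A \<in> mat_class (linf_diff \<alpha>) linf"
    and tail: "\<And>e. e > 0 \<Longrightarrow>
      \<forall>\<^sub>F r in sequentially. \<forall>n. (\<Sum>k. cmod (assoc_mat \<alpha> A n (r + 1 + k))) \<le> e"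
    and s: "\<And>m. s m \<in> linf_diff \<alpha>" and sM: "\<And>m. linf_diff_norm \<alpha> (s m) \<le> M"
  shows "\<exists>f::nat \<Rightarrow> nat. strict_mono f \<and>
    (\<exists>y\<in>linf. (\<lambda>m. linf_norm (\<lambda>k. mat_op A (s (f m)) k - y k)) \<longlonglongrightarrow> 0)"
proof -
  let ?a = "assoc_mat \<alpha> A"
  define y where "y m = frac_diff \<alpha> (s m)" for m
  have y: "y m \<in> linf" for m
    using s by (simp add: y_def linf_diff_def)
  have yM: "cmod (y m k) \<le> M" for m k
    using norm_le_linf_norm[OF y] sM[of m] by (metis linf_diff_norm_def order.trans y_def)
  \<comment> \<open>Diagonal selection over the countable set of coordinates, each bounded by
    \<open>M\<close>.\<close>
  obtain f :: "nat \<Rightarrow> nat" where f: "strict_mono f" and ex: "\<And>k. \<exists>l. (\<lambda>m. y (f m) k) \<longlonglongrightarrow> l"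
    using function_convergent_subsequence[of "UNIV :: nat set" y M] yM by auto
  from ex obtain w where w: "\<And>k. (\<lambda>m. y (f m) k) \<longlonglongrightarrow> w k"
    by metis
  have wM: "cmod (w k) \<le> M" for k
    using tendsto_norm[OF w[of k]] yM by (intro LIMSEQ_le_const2) auto
  then have w_linf: "w \<in> linf"
    by (rule linfI)
  define z where "z = mat_op A (frac_diff (-\<alpha>) w)"
  have z: "z \<in> linf"
    using A frac_diff_neg_in_linf_diff[OF \<alpha> w_linf] by (auto simp: z_def mat_class_def)
  obtain B where B: "\<And>k n. cmod (?a n k) \<le> B k"
    using assoc_mat_col_bounded[OF \<alpha> A] by metis
  have "(\<lambda>m. linf_norm (\<lambda>n. mat_op A (s (f m)) n - z n)) \<longlonglongrightarrow> 0"
  proof (rule LIMSEQ_I)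
    fix e :: real assume "e > 0"
    have "M \<ge> 0"
      using yM[of 0 0] norm_ge_zero[of "y 0 0"] by linarith
    \<comment> \<open>The differences \<open>v\<close> are bounded by \<open>2 * M\<close>, so tails
      below \<open>d\<close> contribute at most \<open>e / 4\<close>; the added 1 covers
      \<open>M = 0\<close>.\<close>
    define d where "d = e / (4 * (2 * M + 1))"
    have "d > 0" using \<open>e > 0\<close> \<open>M \<ge> 0\<close> by (simp add: d_def)
    have d: "d * (2 * M) \<le> e / 4"
      using \<open>e > 0\<close> \<open>M \<ge> 0\<close> by (simp add: d_def field_simps)
    obtain r where r: "\<And>n. (\<Sum>k. cmod (?a n (r + 1 + k))) \<le> d"
      using tail[OF \<open>d > 0\<close>] unfolding eventually_sequentially by blast
    \<comment> \<open>The bounds \<open>B k\<close> are independent of the row, so coordinatewise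
      convergence in finitely many columns is enough for all rows at once.\<close>
    have "(\<lambda>m. \<Sum>k<r + 1. B k * cmod (y (f m) k - w k)) \<longlonglongrightarrow> (\<Sum>k<r + 1. B k * cmod (w k - w k))"
      by (intro tendsto_intros w)
    then have "\<forall>\<^sub>F m in sequentially. (\<Sum>k<r + 1. B k * cmod (y (f m) k - w k)) < e / 4"
      by (rule order_tendstoD(2)) (use \<open>e > 0\<close> in simp)
    then have "\<forall>\<^sub>F m in sequentially. norm (linf_norm (\<lambda>n. mat_op A (s (f m)) n - z n) - 0) < e"
    proof eventually_elim
      case (elim m)
      define v where "v k = y (f m) k - w k" for k
      have v: "cmod (v k) \<le> 2 * M" for k
        using norm_triangle_ineq4[of "y (f m) k" "w k"] yM[of "f m" k] wM[of k]
        by (simp add: v_def)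
      have le: "cmod (mat_op A (s (f m)) n - z n) \<le> e / 2" for n
      proof -
        have "(\<lambda>k. ?a n k * y (f m) k - ?a n k * w k) sums (mat_op A (s (f m)) n - z n)"
          unfolding y_def z_def
          by (intro sums_diff assoc_mat_sums[OF \<alpha> A s] assoc_mat_sums'[OF \<alpha> A w_linf])
        then have sums: "(\<lambda>k. ?a n k * v k) sums (mat_op A (s (f m)) n - z n)"
          by (simp add: v_def right_diff_distrib)
        have "(\<lambda>k. ?a n (k + (r + 1)) * v (k + (r + 1))) sums
            (mat_op A (s (f m)) n - z n - (\<Sum>k<r + 1. ?a n k * v k))"
          by (rule sums_split_initial_segment[OF sums])
        then have eq: "mat_op A (s (f m)) n - z n =
            (\<Sum>k<r + 1. ?a n k * v k) + (\<Sum>k. ?a n (r + 1 + k) * v (r + 1 + k))"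
          by (simp add: sums_iff algebra_simps)
        have "cmod (\<Sum>k<r + 1. ?a n k * v k) \<le> (\<Sum>k<r + 1. B k * cmod (v k))"
          by (intro sum_norm_le) (simp add: norm_mult mult_right_mono B)
        moreover have "cmod (\<Sum>k. ?a n (r + 1 + k) * v (r + 1 + k)) \<le> e / 4"
        proof -
          have summ: "summable (\<lambda>k. cmod (?a n (r + 1 + k)))"
            using summable_ignore_initial_segment[OF assoc_mat_abs_summable[OF \<alpha> A, of n], of "r + 1"]
            by (simp add: add_ac)
          have "cmod (\<Sum>k. ?a n (r + 1 + k) * v (r + 1 + k)) \<le> (\<Sum>k. cmod (?a n (r + 1 + k)) * (2 * M))"
            by (intro norm_suminf_le summable_mult2 summ) (simp add: norm_mult mult_left_mono v)
          also have "\<dots> = (\<Sum>k. cmod (?a n (r + 1 + k))) * (2 * M)"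
            by (rule suminf_mult2[OF summ, symmetric])
          also have "\<dots> \<le> d * (2 * M)"
            using r \<open>M \<ge> 0\<close> by (intro mult_right_mono) auto
          finally show ?thesis using d by linarith
        qed
        ultimately show ?thesis
          unfolding eq using elim norm_triangle_ineq[of "\<Sum>k<r + 1. ?a n k * v k"
              "\<Sum>k. ?a n (r + 1 + k) * v (r + 1 + k)"] unfolding v_def by linarith
      qed
      have "linf_norm (\<lambda>n. mat_op A (s (f m)) n - z n) \<le> e / 2"
        using le by (rule linf_norm_le)
      moreover have "0 \<le> linf_norm (\<lambda>n. mat_op A (s (f m)) n - z n)"
      proof -
        have "(\<lambda>n. mat_op A (s (f m)) n - z n) \<in> linf"
          using le by (rule linfI)
        from norm_le_linf_norm[OF this, of 0] show ?thesis
          by (rule order.trans[OF norm_ge_zero])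
      qed
      ultimately show ?case
        using \<open>e > 0\<close> by simp
    qed
    then show "\<exists>no. \<forall>m\<ge>no. norm (linf_norm (\<lambda>n. mat_op A (s (f m)) n - z n) - 0) < e"
      by (simp add: eventually_sequentially)
  qed
  with f z show ?thesis by blast
qed

section \<open>Linearity and the equivalence\<close>

lemma mat_op_add:
  assumes "A \<in> mat_class X Y" "x \<in> X" "y \<in> X"
  shows "mat_op A (\<lambda>k. x k + y k) = (\<lambda>k. mat_op A x k + mat_op A y k)"
  using assms by (auto simp: mat_op_def mat_class_def distrib_left suminf_add)

lemma mat_op_mult:
  assumes "A \<in> mat_class X Y" "x \<in> X"
  shows "mat_op A (\<lambda>k. c * x k) = (\<lambda>k. c * mat_op A x k)"
  using assms by (auto simp: mat_op_def mat_class_def mult.left_commute[of _ c] suminf_mult)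

theorem theorem3p10:
  fixes \<alpha> :: real and A :: "nat \<Rightarrow> nat \<Rightarrow> complex"
  assumes "\<alpha> \<notin> \<int>"
    and "A \<in> mat_class (linf_diff \<alpha>) linf"
  shows "compact_operator (linf_diff \<alpha>) (linf_diff_norm \<alpha>) linf linf_norm (mat_op A) \<longleftrightarrow>
    (\<lambda>r. SUP n. \<Sum>k. ennreal (cmod (assoc_mat \<alpha> A n (r + 1 + k)))) \<longlonglongrightarrow> 0"
proof -
  \<comment> \<open>Summability identifies the \<open>ennreal\<close> row tails with real ones, so
    that the epsilon form applies.\<close>
  have "summable (\<lambda>k. cmod (assoc_mat \<alpha> A n (r + 1 + k)))" for n r
    using summable_ignore_initial_segment[OF assoc_mat_abs_summable[OF assms, of n], of "r + 1"]
    by (simp add: add_ac)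
  then have "(\<lambda>r. SUP n. \<Sum>k. ennreal (cmod (assoc_mat \<alpha> A n (r + 1 + k)))) \<longlonglongrightarrow> 0 \<longleftrightarrow>
      (\<forall>e>0. \<forall>\<^sub>F r in sequentially. \<forall>n. (\<Sum>k. cmod (assoc_mat \<alpha> A n (r + 1 + k))) \<le> e)"
    by (simp only: suminf_ennreal2 norm_ge_zero SUP_ennreal_tendsto_zero_iff)
  moreover have "compact_operator (linf_diff \<alpha>) (linf_diff_norm \<alpha>) linf linf_norm (mat_op A)"
    if tail: "\<forall>e>0. \<forall>\<^sub>F r in sequentially. \<forall>n. (\<Sum>k. cmod (assoc_mat \<alpha> A n (r + 1 + k))) \<le> e"
    unfolding compact_operator_def
  proof (intro conjI)
    show "mat_op A ` linf_diff \<alpha> \<subseteq> linf"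
      using assms(2) by (auto simp: mat_class_def)
    show "\<forall>s. (\<forall>m. s m \<in> linf_diff \<alpha>) \<and> (\<exists>M. \<forall>m. linf_diff_norm \<alpha> (s m) \<le> M) \<longrightarrow>
        (\<exists>f::nat \<Rightarrow> nat. strict_mono f \<and>
          (\<exists>y\<in>linf. (\<lambda>m. linf_norm (\<lambda>k. mat_op A (s (f m)) k - y k)) \<longlonglongrightarrow> 0))"
      using uniform_tail_imp_compact[OF assms] tail by blast
  qed (use assms(2) in \<open>auto simp: mat_op_add mat_op_mult\<close>)
  ultimately show ?thesis
    using compact_imp_uniform_tail[OF assms] by blast
qed

end
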